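(* Let $M$ be an $n\times n$ $q$-Manin matrix over $\mathfrak R$ and let $M^{adj}$ be the $n\times n$ matrix with entries $$M^{adj}_{sr}=(-q)^{r-s}\det\nolimits_q M_{\backslash r\backslash s},$$ where $M_{\backslash r\backslash s}$ is the $(n-1)\times(n-1)$ submatrix of $M$ obtained by deleting the $r$-th row and the $s$-th column. Then $$M^{adj}M=\det\nolimits_q M\cdot 1_{n\times n},$$ i.e. $M^{adj}$ is a left adjoint matrix for $M$.
   Context: Let $q$ be a nonzero complex number and $\mathfrak R$ an associative unital, not necessarily commutative, algebra over $\mathbb C$. A matrix $M=(M_{ij})$ over $\mathfrak R$ is called $q$-Manin if $M_{ij}M_{kj}=q^{-1}M_{kj}M_{ij}$ for all $j$ and all $i<k$, and $M_{ij}M_{kl}-M_{kl}M_{ij}=q^{-1}M_{kj}M_{il}-q\,M_{il}M_{kj}$ for all $i<k$, $j<l$. The $q$-determinant of an $n\times n$ matrix is $\det_q M=\sum_{\tau\in\mathfrak S_n}(-q)^{-\mathrm{inv}(\tau)}M_{\tau(1)1}M_{\tau(2)2}\cdots M_{\tau(n)n}$, where $\mathrm{inv}(\tau)$ is the number of inversions of $\tau$ (and $\det_q$ of an empty matrix is $1$). *)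

theory Defs
  imports
    Complex_Main
    "HOL-Combinatorics.Permutations"
    "Jordan_Normal_Form.Determinant"
begin

(* Class ring_1 would add 0 \<noteq> 1; the sort {ring, monoid_mult} admits the zero algebra. *)
locale complex_unital_algebra = vector_space scale
  for scale :: "complex \<Rightarrow> 'a::{ring,monoid_mult} \<Rightarrow> 'a" +
  assumes scale_mult_left: "scale c x * y = scale c (x * y)"
    and scale_mult_right: "x * scale c y = scale c (x * y)"

definition q_manin :: "(complex \<Rightarrow> 'a::{ring,monoid_mult} \<Rightarrow> 'a) \<Rightarrow> complex \<Rightarrow> 'a mat \<Rightarrow> bool" where
  "q_manin scale q M \<longleftrightarrow>
     (\<forall>i k j. i < k \<and> k < dim_row M \<and> j < dim_col M \<longrightarrow>
        M $$ (i,j) * M $$ (k,j) = scale (inverse q) (M $$ (k,j) * M $$ (i,j))) \<and>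
     (\<forall>i k j l. i < k \<and> k < dim_row M \<and> j < l \<and> l < dim_col M \<longrightarrow>
        M $$ (i,j) * M $$ (k,l) - M $$ (k,l) * M $$ (i,j) =
        scale (inverse q) (M $$ (k,j) * M $$ (i,l)) - scale q (M $$ (i,l) * M $$ (k,j)))"

definition inversion_number :: "nat \<Rightarrow> (nat \<Rightarrow> nat) \<Rightarrow> nat" where
  "inversion_number n \<tau> = card {(i,j). i < j \<and> j < n \<and> \<tau> j < \<tau> i}"

(* Intended for square M. The list product fixes the order of the factors by increasing column. *)
definition q_det :: "(complex \<Rightarrow> 'a::{ring,monoid_mult} \<Rightarrow> 'a) \<Rightarrow> complex \<Rightarrow> 'a mat \<Rightarrow> 'a" where
  "q_det scale q M =
     (\<Sum>\<tau> | \<tau> permutes {0..<dim_row M}.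
        scale ((- q) powi (- int (inversion_number (dim_row M) \<tau>)))
          (prod_list (map (\<lambda>j. M $$ (\<tau> j, j)) [0..<dim_row M])))"

(* Indices start at 0, which does not affect the exponent r - s. *)
definition q_adj :: "(complex \<Rightarrow> 'a::{ring,monoid_mult} \<Rightarrow> 'a) \<Rightarrow> complex \<Rightarrow> 'a mat \<Rightarrow> 'a mat" where
  "q_adj scale q M = mat (dim_row M) (dim_row M)
     (\<lambda>(s,r). scale ((- q) powi (int r - int s)) (q_det scale q (mat_delete M r s)))"

end

theory Submission
  imports Defs
begin

text \<open>
  The \<open>(s,t)\<close> entry of the product is
  \<open>\<Sum>\<^sub>r (-q)\<^bsup>r-s\<^esup> det\<^sub>q(M without row r and column s) M\<^sub>r\<^sub>t\<close>. Up to the power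
  \<open>(-q)\<^bsup>n-1-s\<^esup>\<close> this is the expansion along the last column of a single \<open>q\<close>-determinant,
  namely that of the matrix \<open>N\<close> obtained from \<open>M\<close> by deleting column \<open>s\<close> and appending
  column \<open>t\<close> at the right end (\<open>q_det_expand_last_column\<close>). This expansion is a mere regrouping of
  terms, since the entries of the last column already stand rightmost in each product. It remains
  to evaluate \<open>det\<^sub>q N\<close>.

  The Manin relations enter through adjacent columns. Pairing each permutation with its composite
  with the transposition of \<open>k\<close> and \<open>k+1\<close>, which changes the number of inversions by one, shows
  that columns \<open>k\<close> and \<open>k+1\<close> affect a \<open>q\<close>-determinant only through their \<open>2\<times>2\<close>
  \<open>q\<close>-minors (\<open>q_det_adjacent_minors\<close>). The defining relations of a \<open>q\<close>-Manin matrix say exactly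
  that such a minor vanishes when the two columns coincide, and is multiplied by \<open>(-q)\<^bsup>-1\<^esup>\<close> when
  two increasing columns are exchanged. Both properties therefore pass to \<open>q\<close>-determinants of
  matrices assembled from columns of \<open>M\<close> (\<open>q_det_select_columns_swap\<close>,
  \<open>q_det_select_columns_repeated\<close>).

  Now move the appended column \<open>t\<close> of \<open>N\<close> to the left past larger columns. If \<open>t = s\<close>, it
  reaches its original place after \<open>n-1-s\<close> exchanges, which recovers \<open>M\<close> and cancels the power of
  \<open>-q\<close>. If \<open>t \<noteq> s\<close>, it becomes adjacent to the other copy of column \<open>t\<close>, and the determinant
  is zero.
\<close>

section \<open>Inversions\<close>

text \<open>
  Precomposing with an adjacent transposition \<open>s\<close> moves the inversions by \<open>s \<times> s\<close>; only the pair
  \<open>(k, k+1)\<close>, whose order \<open>s\<close> reverses, changes its status.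
\<close>

lemma inversion_number_comp_transpose:
  assumes k: "Suc k < n" and asc: "\<tau> k < \<tau> (Suc k)"
  shows "inversion_number n (\<tau> \<circ> transpose k (Suc k)) = Suc (inversion_number n \<tau>)"
proof -
  define s where "s = transpose k (Suc k)"
  define I where "I \<sigma> = {(i,j). i < j \<and> j < n \<and> \<sigma> j < \<sigma> i}" for \<sigma> :: "nat \<Rightarrow> nat"
  have s_simps: "s k = Suc k" "s (Suc k) = k" "\<And>i. i \<noteq> k \<Longrightarrow> i \<noteq> Suc k \<Longrightarrow> s i = i"
    by (auto simp: s_def)
  have ss: "s (s i) = i" for i by (simp add: s_def)
  have s_less: "s i < s j" if "i < j" "(i, j) \<noteq> (k, Suc k)" for i j
    using that unfolding s_def transpose_def by auto
  have s_bound: "s j < n" if "j < n" for j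
    using that k unfolding s_def transpose_def by auto
  have fin: "finite (I \<tau>)"
    by (rule finite_subset[of _ "{..<n} \<times> {..<n}"]) (auto simp: I_def)
  have I_eq: "I (\<tau> \<circ> s) = insert (k, Suc k) (map_prod s s ` I \<tau>)"
  proof (intro subset_antisym subrelI)
    fix i j assume ij: "(i, j) \<in> I (\<tau> \<circ> s)"
    show "(i, j) \<in> insert (k, Suc k) (map_prod s s ` I \<tau>)"
    proof (cases "(i, j) = (k, Suc k)")
      case False
      with ij have "(s i, s j) \<in> I \<tau>"
        using s_less s_bound by (auto simp: I_def)
      moreover have "(i, j) = map_prod s s (s i, s j)" by (simp add: ss)
      ultimately show ?thesis by blast
    qed simp
  next
    fix i j assume "(i, j) \<in> insert (k, Suc k) (map_prod s s ` I \<tau>)"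
    then consider "(i, j) = (k, Suc k)"
      | a b where "(a, b) \<in> I \<tau>" "i = s a" "j = s b" by auto
    then show "(i, j) \<in> I (\<tau> \<circ> s)"
    proof cases
      case 1
      then show ?thesis using k asc by (auto simp: I_def s_simps)
    next
      case 2
      have "(a, b) \<noteq> (k, Suc k)" using 2(1) asc by (auto simp: I_def)
      then show ?thesis using 2 s_less s_bound by (auto simp: I_def ss)
    qed
  qed
  have "(k, Suc k) \<notin> map_prod s s ` I \<tau>"
  proof
    assume "(k, Suc k) \<in> map_prod s s ` I \<tau>"
    then obtain a b where ab: "a < b" "s a = k" "s b = Suc k" by (auto simp: I_def)
    then have "a = Suc k" "b = k" using ss[of a] ss[of b] by (auto simp: s_simps)
    with ab show False by simp
  qed
  moreover have "inj_on (map_prod s s) (I \<tau>)"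
    by (rule inj_onI) (metis map_prod_simp prod.collapse prod.inject ss)
  ultimately have "card (I (\<tau> \<circ> s)) = Suc (card (I \<tau>))"
    using fin by (simp add: I_eq card_image)
  then show ?thesis by (simp add: inversion_number_def I_def s_def)
qed

text \<open>
  The new last value \<open>r\<close> is in inversion exactly with the \<open>n - r\<close> larger values, which all stand
  before it; inserting it shifts the other values monotonically, so their inversions persist.
\<close>

lemma inversion_number_permutation_insert_last:
  assumes p: "p permutes {0..<n}" and r: "r < Suc n"
  shows "inversion_number (Suc n) (permutation_insert n r p) = inversion_number n p + (n - r)"
proof -
  let ?\<tau> = "permutation_insert n r p"
  have \<tau>_last: "?\<tau> n = r" by simp
  have \<tau>_init: "?\<tau> i = insert_index r (p i)" if "i < n" for i
    using that by (simp add: permutation_insert_expand insert_index_def)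
  have ins_less: "insert_index r a < insert_index r b \<longleftrightarrow> a < b" for a b
    by (auto simp: insert_index_def)
  define I where "I = {(i,j). i < j \<and> j < n \<and> p j < p i}"
  define L where "L = {i. i < n \<and> r \<le> p i}"
  have "{(i,j). i < j \<and> j < Suc n \<and> ?\<tau> j < ?\<tau> i} = I \<union> (\<lambda>i. (i, n)) ` L"
    by (auto simp: I_def L_def less_Suc_eq \<tau>_init ins_less insert_index_def split: if_splits)
  moreover have "finite I"
    by (rule finite_subset[of _ "{..<n} \<times> {..<n}"]) (auto simp: I_def)
  moreover have "finite L" by (simp add: L_def)
  moreover have "I \<inter> (\<lambda>i. (i, n)) ` L = {}" by (auto simp: I_def)
  ultimately have "inversion_number (Suc n) ?\<tau> = card I + card ((\<lambda>i. (i, n)) ` L)"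
    by (simp add: inversion_number_def card_Un_disjoint)
  also have "card ((\<lambda>i. (i, n)) ` L) = card L"
    by (rule card_image) (auto intro: inj_onI)
  also have "card L = card (p ` L)"
    using permutes_inj[OF p] by (metis card_image inj_on_subset subset_UNIV)
  also have "p ` L = {r..<n}"
  proof
    show "p ` L \<subseteq> {r..<n}"
    proof
      fix y assume "y \<in> p ` L"
      then obtain i where "y = p i" "i < n" "r \<le> p i" by (auto simp: L_def)
      moreover have "p i < n" using permutes_in_image[OF p, of i] \<open>i < n\<close> by simp
      ultimately show "y \<in> {r..<n}" by simp
    qed
    show "{r..<n} \<subseteq> p ` L"
    proof
      fix y assume y: "y \<in> {r..<n}"
      then have "y \<in> p ` {0..<n}" using permutes_image[OF p] by auto
      then show "y \<in> p ` L" using y by (auto simp: L_def)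
    qed
  qed
  finally show ?thesis by (simp add: inversion_number_def I_def)
qed

section \<open>Adjacent columns of a q-determinant\<close>

definition q_minor :: "(complex \<Rightarrow> 'a::{ring,monoid_mult} \<Rightarrow> 'a) \<Rightarrow> complex \<Rightarrow> 'a mat
    \<Rightarrow> nat \<Rightarrow> nat \<Rightarrow> nat \<Rightarrow> nat \<Rightarrow> 'a" where
  "q_minor scale q M i i' j l =
     M $$ (i,j) * M $$ (i',l) - scale (inverse q) (M $$ (i',j) * M $$ (i,l))"

definition select_columns :: "'a mat \<Rightarrow> (nat \<Rightarrow> nat) \<Rightarrow> 'a mat" where
  "select_columns M w = mat (dim_row M) (dim_col M) (\<lambda>(i,j). M $$ (i, w j))"

lemma upt_split_adjacent:
  assumes "Suc k < n"
  shows "[0..<n] = [0..<k] @ [k, Suc k] @ [Suc (Suc k)..<n]"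
proof -
  have "[0..<n] = [0..<k] @ [k..<n]"
    using assms upt_add_eq_append[of 0 k "n - k"] by simp
  also have "[k..<n] = k # Suc k # [Suc (Suc k)..<n]"
    using assms by (simp add: upt_conv_Cons)
  finally show ?thesis by simp
qed

context complex_unital_algebra
begin

text \<open>
  A permutation with \<open>\<tau> k < \<tau> (k+1)\<close> and its composite with the transposition of \<open>k\<close> and
  \<open>k+1\<close> give products that differ only in the two adjacent factors at \<open>k\<close> and \<open>k+1\<close>, and their
  coefficients differ by the factor \<open>-q\<^bsup>-1\<^esup>\<close>. Hence the two terms add up to one term in which
  these factors are replaced by a \<open>q\<close>-minor.
\<close>

lemma q_det_adjacent_minors:
  assumes A: "A \<in> carrier_mat n n" and k: "Suc k < n" and q: "q \<noteq> 0"
  shows "q_det scale q A =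
    (\<Sum>\<tau> | \<tau> permutes {0..<n} \<and> \<tau> k < \<tau> (Suc k).
       scale ((- q) powi (- int (inversion_number n \<tau>)))
         (prod_list (map (\<lambda>j. A $$ (\<tau> j, j)) [0..<k])
          * q_minor scale q A (\<tau> k) (\<tau> (Suc k)) k (Suc k)
          * prod_list (map (\<lambda>j. A $$ (\<tau> j, j)) [Suc (Suc k)..<n])))"
proof -
  define s where "s = transpose k (Suc k)"
  define Up where "Up = {\<tau>. \<tau> permutes {0..<n} \<and> \<tau> k < \<tau> (Suc k)}"
  define Down where "Down = {\<tau>. \<tau> permutes {0..<n} \<and> \<tau> (Suc k) < \<tau> k}"
  define pre where "pre \<tau> = prod_list (map (\<lambda>j. A $$ (\<tau> j, j)) [0..<k])" for \<tau>
  define post where "post \<tau> = prod_list (map (\<lambda>j. A $$ (\<tau> j, j)) [Suc (Suc k)..<n])" for \<tau>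
  define f where "f \<tau> = scale ((- q) powi (- int (inversion_number n \<tau>)))
          (prod_list (map (\<lambda>j. A $$ (\<tau> j, j)) [0..<n]))" for \<tau>
  have f_split: "f \<tau> = scale ((- q) powi (- int (inversion_number n \<tau>)))
      (pre \<tau> * (A $$ (\<tau> k, k) * A $$ (\<tau> (Suc k), Suc k)) * post \<tau>)" for \<tau>
    by (simp add: f_def pre_def post_def upt_split_adjacent[OF k] mult.assoc)
  have s_perm: "s permutes {0..<n}"
    unfolding s_def by (rule permutes_swap_id) (use k in auto)
  have ss: "\<sigma> \<circ> s \<circ> s = \<sigma>" for \<sigma> :: "nat \<Rightarrow> nat"
    by (simp add: s_def comp_assoc)
  have fin: "finite Up" "finite Down"
    by (auto intro: finite_subset[OF _ finite_permutations[of "{0..<n}"]] simp: Up_def Down_def)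
  have "{\<tau>. \<tau> permutes {0..<n}} = Up \<union> Down"
  proof -
    have "\<tau> k \<noteq> \<tau> (Suc k)" if "\<tau> permutes {0..<n}" for \<tau>
      using permutes_inj[OF that] by (metis injD n_not_Suc_n)
    then show ?thesis unfolding Up_def Down_def using linorder_neqE_nat by blast
  qed
  moreover have "Up \<inter> Down = {}" by (auto simp: Up_def Down_def)
  ultimately have "q_det scale q A = sum f Up + sum f Down"
    using A fin by (simp add: q_det_def f_def sum.union_disjoint)
  also have "sum f Down = (\<Sum>\<tau>\<in>Up. f (\<tau> \<circ> s))"
  proof (rule sum.reindex_bij_witness[where i = "\<lambda>\<tau>. \<tau> \<circ> s" and j = "\<lambda>\<tau>. \<tau> \<circ> s"])
    show "\<And>\<tau>. \<tau> \<in> Down \<Longrightarrow> \<tau> \<circ> s \<in> Up" "\<And>\<tau>. \<tau> \<in> Up \<Longrightarrow> \<tau> \<circ> s \<in> Down"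
      using permutes_compose[OF s_perm] by (auto simp: Up_def Down_def s_def)
  qed (auto simp: ss)
  also have "sum f Up + (\<Sum>\<tau>\<in>Up. f (\<tau> \<circ> s)) = (\<Sum>\<tau>\<in>Up. f \<tau> + f (\<tau> \<circ> s))"
    by (simp add: sum.distrib)
  also have "\<dots> = (\<Sum>\<tau>\<in>Up. scale ((- q) powi (- int (inversion_number n \<tau>)))
      (pre \<tau> * q_minor scale q A (\<tau> k) (\<tau> (Suc k)) k (Suc k) * post \<tau>))"
  proof (rule sum.cong[OF refl])
    fix \<tau> assume "\<tau> \<in> Up"
    then have asc: "\<tau> k < \<tau> (Suc k)" by (simp add: Up_def)
    let ?c = "(- q) powi (- int (inversion_number n \<tau>))"
    have "(- q) powi (- int (inversion_number n (\<tau> \<circ> s))) = ?c * (- inverse q)"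
    proof -
      have inv: "- int (inversion_number n (\<tau> \<circ> s)) = - int (inversion_number n \<tau>) + (- 1)"
        using inversion_number_comp_transpose[OF k, of \<tau>] asc by (simp add: s_def)
      show ?thesis unfolding inv using q by (subst power_int_add) (simp_all add: power_int_minus)
    qed
    moreover have "pre (\<tau> \<circ> s) = pre \<tau>" "post (\<tau> \<circ> s) = post \<tau>"
      unfolding pre_def post_def s_def
      by (auto intro!: arg_cong[where f = prod_list] simp: transpose_def)
    ultimately have "f (\<tau> \<circ> s) = scale (?c * (- inverse q))
        (pre \<tau> * (A $$ (\<tau> (Suc k), k) * A $$ (\<tau> k, Suc k)) * post \<tau>)"
      unfolding f_split by (simp add: s_def)
    also have "\<dots> = scale ?c (pre \<tau> *
        (- scale (inverse q) (A $$ (\<tau> (Suc k), k) * A $$ (\<tau> k, Suc k))) * post \<tau>)"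
      by (simp add: scale_mult_left scale_mult_right)
    finally show "f \<tau> + f (\<tau> \<circ> s) = scale ?c
      (pre \<tau> * q_minor scale q A (\<tau> k) (\<tau> (Suc k)) k (Suc k) * post \<tau>)"
      unfolding f_split q_minor_def
      by (simp add: scale_right_diff_distrib ring_distribs)
  qed
  finally show ?thesis by (simp add: Up_def pre_def post_def)
qed

text \<open>
  This transfers relations between minors of two adjacent columns to whole determinants: the choice
  of \<open>c\<close> as \<open>(-q)\<^bsup>-1\<^esup>\<close> gives the exchange of columns, and \<open>c = 0\<close> the vanishing for repeated
  columns.
\<close>

lemma q_det_scale_adjacent_minors:
  assumes A: "A \<in> carrier_mat n n" and B: "B \<in> carrier_mat n n"
    and k: "Suc k < n" and q: "q \<noteq> 0"
    and same: "\<And>i j. i < n \<Longrightarrow> j < n \<Longrightarrow> j \<noteq> k \<Longrightarrow> j \<noteq> Suc k \<Longrightarrow> A $$ (i,j) = B $$ (i,j)"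
    and minors: "\<And>i i'. i < i' \<Longrightarrow> i' < n \<Longrightarrow>
      q_minor scale q A i i' k (Suc k) = scale c (q_minor scale q B i i' k (Suc k))"
  shows "q_det scale q A = scale c (q_det scale q B)"
  unfolding q_det_adjacent_minors[OF A k q] q_det_adjacent_minors[OF B k q] scale_sum_right
proof (rule sum.cong[OF refl], goal_cases)
  case (1 \<tau>)
  then have \<tau>: "\<tau> permutes {0..<n}" "\<tau> k < \<tau> (Suc k)" by auto
  have bound: "\<tau> j < n" if "j < n" for j using permutes_in_image[OF \<tau>(1), of j] that by simp
  have factors: "map (\<lambda>j. A $$ (\<tau> j, j)) [0..<k] = map (\<lambda>j. B $$ (\<tau> j, j)) [0..<k]"
    "map (\<lambda>j. A $$ (\<tau> j, j)) [Suc (Suc k)..<n] = map (\<lambda>j. B $$ (\<tau> j, j)) [Suc (Suc k)..<n]"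
    using k by (auto intro!: same bound)
  show ?case
    unfolding factors minors[OF \<tau>(2) bound[OF k]]
    by (simp add: scale_mult_left scale_mult_right mult.commute)
qed

text \<open>
  The relation between rows \<open>i < i'\<close> and columns \<open>j < l\<close>, with its terms regrouped, reads
  \<open>M(i,j) M(i',l) - q\<^bsup>-1\<^esup> M(i',j) M(i,l) = -q (M(i,l) M(i',j) - q\<^bsup>-1\<^esup> M(i',l) M(i,j))\<close>,
  and both sides are \<open>q\<close>-minors.
\<close>

lemma q_manin_minor_swap:
  assumes M: "M \<in> carrier_mat n n" and manin: "q_manin scale q M" and q: "q \<noteq> 0"
    and "i < i'" "i' < n" "j < l" "l < n"
  shows "q_minor scale q M i i' l j = scale (inverse (- q)) (q_minor scale q M i i' j l)"
proof -
  have "M $$ (i,j) * M $$ (i',l) - M $$ (i',l) * M $$ (i,j) =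
      scale (inverse q) (M $$ (i',j) * M $$ (i,l)) - scale q (M $$ (i,l) * M $$ (i',j))"
    using assms by (auto simp: q_manin_def)
  then have "q_minor scale q M i i' j l = M $$ (i',l) * M $$ (i,j) - scale q (M $$ (i,l) * M $$ (i',j))"
    by (simp add: q_minor_def algebra_simps)
  then show ?thesis using q by (simp add: q_minor_def scale_right_diff_distrib)
qed

lemma q_manin_minor_same_column:
  assumes "M \<in> carrier_mat n n" "q_manin scale q M" "i < i'" "i' < n" "j < n"
  shows "q_minor scale q M i i' j j = 0"
  using assms by (auto simp: q_minor_def q_manin_def)

lemma q_minor_select_columns:
  assumes "M \<in> carrier_mat n n" "i < n" "i' < n" "j < n" "l < n"
  shows "q_minor scale q (select_columns M w) i i' j l = q_minor scale q M i i' (w j) (w l)"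
  using assms by (simp add: q_minor_def select_columns_def)

lemma q_det_select_columns_swap:
  assumes M: "M \<in> carrier_mat n n" and manin: "q_manin scale q M" and q: "q \<noteq> 0"
    and k: "Suc k < n" and w: "w k < w (Suc k)" "w (Suc k) < n"
  shows "q_det scale q (select_columns M (w \<circ> transpose k (Suc k))) =
    scale (inverse (- q)) (q_det scale q (select_columns M w))"
proof (rule q_det_scale_adjacent_minors[OF _ _ k q])
  fix i i' assume i: "i < i'" "i' < n"
  show "q_minor scale q (select_columns M (w \<circ> transpose k (Suc k))) i i' k (Suc k) =
      scale (inverse (- q)) (q_minor scale q (select_columns M w) i i' k (Suc k))"
    using q_manin_minor_swap[OF M manin q i w] M i k
    by (simp add: q_minor_select_columns)
next
  fix i j :: nat
  assume "i < n" "j < n" "j \<noteq> k" "j \<noteq> Suc k"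
  then show "select_columns M (w \<circ> transpose k (Suc k)) $$ (i, j) = select_columns M w $$ (i, j)"
    using M by (simp add: select_columns_def)
qed (use M in \<open>auto simp: select_columns_def\<close>)

lemma q_det_select_columns_repeated:
  assumes M: "M \<in> carrier_mat n n" and manin: "q_manin scale q M" and q: "q \<noteq> 0"
    and k: "Suc k < n" and w: "w k = w (Suc k)" "w (Suc k) < n"
  shows "q_det scale q (select_columns M w) = 0"
proof -
  have A: "select_columns M w \<in> carrier_mat n n" using M by (auto simp: select_columns_def)
  have "q_det scale q (select_columns M w) = scale 0 (q_det scale q (select_columns M w))"
    by (rule q_det_scale_adjacent_minors[OF A A k q refl])
      (use q_manin_minor_same_column[OF M manin] M k w in \<open>simp add: q_minor_select_columns\<close>)
  then show ?thesis by simp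
qed

section \<open>Expansion along the last column\<close>

text \<open>
  Group the permutations by the value \<open>r\<close> that they take at the last place. Removing that value
  leaves a permutation for the matrix without row \<open>r\<close>, and the \<open>n - r\<close> inversions lost account for
  the power of \<open>-q\<close>.
\<close>

lemma q_det_expand_last_column:
  assumes A: "A \<in> carrier_mat (Suc n) (Suc n)" and q: "q \<noteq> 0"
  shows "q_det scale q A =
    (\<Sum>r<Suc n. scale ((- q) powi (int r - int n)) (q_det scale q (mat_delete A r n) * A $$ (r, n)))"
proof -
  define f where "f \<tau> = scale ((- q) powi (- int (inversion_number (Suc n) \<tau>)))
          (prod_list (map (\<lambda>j. A $$ (\<tau> j, j)) [0..<Suc n]))" for \<tau>
  have "q_det scale q A = sum f {\<tau>. \<tau> permutes {0..<Suc n}}"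
    using A by (simp add: q_det_def f_def[abs_def] del: upt_Suc)
  also have "{\<tau>. \<tau> permutes {0..<Suc n}} =
      (\<Union>r\<in>{..<Suc n}. {\<tau>. \<tau> permutes {0..<Suc n} \<and> \<tau> n = r})"
    by (auto dest: permutes_in_image[where x = n])
  also have "sum f \<dots> = (\<Sum>r<Suc n. sum f {\<tau>. \<tau> permutes {0..<Suc n} \<and> \<tau> n = r})"
    by (rule sum.UNION_disjoint)
      (auto intro: finite_subset[OF _ finite_permutations[of "{0..<Suc n}"]])
  also have "\<dots> = (\<Sum>r<Suc n. scale ((- q) powi (int r - int n))
      (q_det scale q (mat_delete A r n) * A $$ (r, n)))"
  proof (rule sum.cong[OF refl])
    fix r assume "r \<in> {..<Suc n}"
    then have r: "r < Suc n" by simp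
    have term_eq: "f (permutation_insert n r p) = scale ((- q) powi (int r - int n))
        (scale ((- q) powi (- int (inversion_number n p)))
          (prod_list (map (\<lambda>j. mat_delete A r n $$ (p j, j)) [0..<n])) * A $$ (r, n))"
      if p: "p permutes {0..<n}" for p
    proof -
      have "A $$ (permutation_insert n r p j, j) = mat_delete A r n $$ (p j, j)" if "j < n" for j
      proof -
        have "p j < n" using permutes_in_image[OF p, of j] that by simp
        moreover have "permutation_insert n r p j = insert_index r (p j)"
          using that by (simp add: permutation_insert_expand insert_index_def)
        ultimately show ?thesis
          using mat_delete_index[OF A r _ _ that, of n "p j"] that by simp
      qed
      then have factors: "map (\<lambda>j. A $$ (permutation_insert n r p j, j)) [0..<n] =
          map (\<lambda>j. mat_delete A r n $$ (p j, j)) [0..<n]" by simp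
      have "(- q) powi (- int (inversion_number (Suc n) (permutation_insert n r p))) =
          (- q) powi (int r - int n) * (- q) powi (- int (inversion_number n p))"
      proof -
        have inv: "- int (inversion_number (Suc n) (permutation_insert n r p)) =
            (int r - int n) + (- int (inversion_number n p))"
          using r by (simp add: inversion_number_permutation_insert_last[OF p r])
        show ?thesis unfolding inv using q by (subst power_int_add) simp_all
      qed
      then show ?thesis by (simp add: f_def factors scale_mult_left)
    qed
    have "sum f {\<tau>. \<tau> permutes {0..<Suc n} \<and> \<tau> n = r} =
        (\<Sum>p | p permutes {0..<n}. f (permutation_insert n r p))"
      using permutation_insert_inj_on[of n n r] r
      by (simp add: permutation_fix sum.reindex)
    also have "\<dots> = scale ((- q) powi (int r - int n))
      (q_det scale q (mat_delete A r n) * A $$ (r, n))"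
      using A by (simp add: term_eq q_det_def scale_sum_right sum_distrib_right)
    finally show "sum f {\<tau>. \<tau> permutes {0..<Suc n} \<and> \<tau> n = r} = \<dots>" .
  qed
  finally show ?thesis .
qed

section \<open>The adjoint identity\<close>

text \<open>
  The map \<open>insert_dom (insert_index s) k t\<close> lists the column indices other than \<open>s\<close> in
  increasing order, with \<open>t\<close> inserted at position \<open>k\<close>. The column \<open>t\<close> travels from position
  \<open>n\<close> down to position \<open>k\<close>; each of the \<open>n - k\<close> steps exchanges it with a larger column and
  contributes a factor \<open>(-q)\<^bsup>-1\<^esup>\<close>.
\<close>

lemma q_det_move_last_column:
  assumes M: "M \<in> carrier_mat (Suc n) (Suc n)" and manin: "q_manin scale q M" and q: "q \<noteq> 0"
    and "k \<le> n" and t: "t < Suc n"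
    and larger: "\<And>j. k \<le> j \<Longrightarrow> j < n \<Longrightarrow> t < insert_index s j"
  shows "q_det scale q (select_columns M (insert_dom (insert_index s) n t)) =
    scale ((- q) powi (int k - int n)) (q_det scale q (select_columns M (insert_dom (insert_index s) k t)))"
  using \<open>k \<le> n\<close> larger
proof (induction k rule: inc_induct)
  case base
  then show ?case by simp
next
  case (step k)
  let ?w = "\<lambda>k. insert_dom (insert_index s) k t"
  have swap: "?w (Suc k) = ?w k \<circ> transpose k (Suc k)"
    by (auto simp: fun_eq_iff insert_dom_def transpose_def)
  have "?w k k < ?w k (Suc k)" "?w k (Suc k) < Suc n"
    using step.prems[of k] \<open>k < n\<close> by (auto simp: insert_dom_def insert_index_def)
  then have "q_det scale q (select_columns M (?w (Suc k))) =
      scale (inverse (- q)) (q_det scale q (select_columns M (?w k)))"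
    unfolding swap using \<open>k < n\<close> by (intro q_det_select_columns_swap[OF M manin q]) auto
  moreover have "(- q) powi (int (Suc k) - int n) * inverse (- q) = (- q) powi (int k - int n)"
  proof -
    have "(- q) powi (int k - int n) = (- q) powi ((int (Suc k) - int n) + (- 1))" by simp
    also have "\<dots> = (- q) powi (int (Suc k) - int n) * (- q) powi (- 1)"
      using q by (intro power_int_add) simp
    finally show ?thesis by (simp add: power_int_minus)
  qed
  moreover have "q_det scale q (select_columns M (?w n)) =
      scale ((- q) powi (int (Suc k) - int n)) (q_det scale q (select_columns M (?w (Suc k))))"
    using step by simp
  ultimately show ?case by (simp only: scale_scale)
qed

lemma q_det_replace_column:
  assumes M: "M \<in> carrier_mat (Suc n) (Suc n)" and manin: "q_manin scale q M" and q: "q \<noteq> 0"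
    and s: "s < Suc n" and t: "t < Suc n"
  shows "q_det scale q (select_columns M (insert_dom (insert_index s) n t)) =
    (if s = t then scale ((- q) powi (int s - int n)) (q_det scale q M) else 0)"
proof (cases "s = t")
  case True
  have "select_columns M (insert_dom (insert_index s) s s) = M"
    using M by (auto simp: select_columns_def insert_dom_def insert_index_def intro!: eq_matI)
  then show ?thesis
    using True s q_det_move_last_column[OF M manin q, of s s s] by simp
next
  case False
  \<comment> \<open>\<open>k\<close> is the position of column \<open>t\<close> once column \<open>s\<close> is deleted; the moving copy of \<open>t\<close> stops
    just to the right of it.\<close>
  define k where "k = delete_index s t"
  have k: "insert_index s k = t" "k < n"
    using False s t insert_delete_index[of t s]
    by (auto simp: k_def delete_index_def)
  let ?w = "insert_dom (insert_index s) (Suc k) t"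
  have "q_det scale q (select_columns M ?w) = 0"
    by (rule q_det_select_columns_repeated[OF M manin q, of k])
      (use k t in \<open>auto simp: insert_dom_def\<close>)
  moreover have "t < insert_index s j" if "Suc k \<le> j" for j
    using that k(1) by (auto simp: insert_index_def split: if_splits)
  ultimately show ?thesis
    using False k q_det_move_last_column[OF M manin q, of "Suc k" t s] t by simp
qed

text \<open>
  Deleting row \<open>r\<close> and the appended last column leaves \<open>M\<close> without row \<open>r\<close> and
  column \<open>s\<close>, so the expansion along that column is the matrix product, term by term,
  up to a common power of \<open>-q\<close>.
\<close>

lemma q_adj_mult_entry:
  assumes M: "M \<in> carrier_mat (Suc n) (Suc n)" and q: "q \<noteq> 0"
    and s: "s < Suc n" and t: "t < Suc n"
  shows "(q_adj scale q M * M) $$ (s, t) =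
    scale ((- q) powi (int n - int s))
      (q_det scale q (select_columns M (insert_dom (insert_index s) n t)))"
proof -
  let ?A = "select_columns M (insert_dom (insert_index s) n t)"
  have A: "?A \<in> carrier_mat (Suc n) (Suc n)" using M by (auto simp: select_columns_def)
  have A_last: "?A $$ (r, n) = M $$ (r, t)" if "r < Suc n" for r
    using that M by (simp add: select_columns_def insert_dom_def)
  have A_delete: "mat_delete ?A r n = mat_delete M r s" if "r < Suc n" for r
    using M s that
    by (auto simp: mat_delete_def select_columns_def insert_dom_def insert_index_def intro!: eq_matI)
  have pow: "(- q) powi (int n - int s) * (- q) powi (int r - int n) = (- q) powi (int r - int s)" for r
    using q power_int_add[of "- q" "int n - int s" "int r - int n"] by simp
  have "(q_adj scale q M * M) $$ (s, t) =
      (\<Sum>r<Suc n. scale ((- q) powi (int r - int s)) (q_det scale q (mat_delete M r s)) * M $$ (r, t))"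
    using M s t by (simp add: q_adj_def scalar_prod_def atLeast0LessThan del: sum.lessThan_Suc)
  also have "\<dots> = scale ((- q) powi (int n - int s)) (q_det scale q ?A)"
    unfolding q_det_expand_last_column[OF A q] scale_sum_right
    by (rule sum.cong) (simp_all add: A_last A_delete pow scale_mult_left)
  finally show ?thesis .
qed

end

theorem proposition3p4:
  fixes scale :: "complex \<Rightarrow> 'a::{ring,monoid_mult} \<Rightarrow> 'a"
    and q :: complex and n :: nat and M :: "'a mat"
  assumes "complex_unital_algebra scale"
    and "q \<noteq> 0"
    and "M \<in> carrier_mat n n"
    and "q_manin scale q M"
  shows "q_adj scale q M * M = q_det scale q M \<cdot>\<^sub>m 1\<^sub>m n"
proof -
  interpret complex_unital_algebra scale by fact
  show ?thesis
  proof (rule eq_matI)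
    fix s t
    assume "s < dim_row (q_det scale q M \<cdot>\<^sub>m 1\<^sub>m n)" "t < dim_col (q_det scale q M \<cdot>\<^sub>m 1\<^sub>m n)"
    then have s: "s < n" and t: "t < n" by simp_all
    then obtain m where n: "n = Suc m" by (cases n) auto
    have M: "M \<in> carrier_mat (Suc m) (Suc m)" using assms(3) n by simp
    have "(- q) powi (int m - int s) * (- q) powi (int s - int m) = 1"
      using assms(2) power_int_add[of "- q" "int m - int s" "int s - int m"] by simp
    then show "(q_adj scale q M * M) $$ (s, t) = (q_det scale q M \<cdot>\<^sub>m 1\<^sub>m n) $$ (s, t)"
      using s t n assms(2)
      by (cases "s = t") (simp_all add: q_adj_mult_entry[OF M] q_det_replace_column[OF M assms(4)])
  qed (use assms(3) in \<open>auto simp: q_adj_def\<close>)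
qed

end
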